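(* Let $q>1$ and $b\ge1$. The distribution $\widetilde\tau\mapsto(1-q^{-1})^b\,q^{-\ell(\widetilde\tau)}$ on the set of $b$-ball flag juggling states is a stationary distribution of the backward flag juggling Markov chain with coin parameter $q$.
   Context: A $b$-ball flag juggling state is a word indexed by positions $0,1,2,\dots$ in which each number $1,\dots,b$ occurs exactly once and all other positions carry $-$. $\ell(\widetilde\tau)$ is the number of pairs of positions $i<j$ such that the entry at $i$ is strictly greater than the entry at $j$, with $-$ treated as $+\infty$ (pairs of two $-$s not counted). Backward flag juggling Markov chain (coin with probability of heads $1/q$, $-$ treated as $+\infty$ when comparing): (1) hold a $-$ and point at the rightmost number of the state; (2) flip the coin: if tails, put down what is held at the pointed position and pick up the number that was there; if heads, do nothing; (3) move leftwards from the current position, stopping at the first number strictly smaller than what is held; (4) if such a number is met, go back to (2) pointing at it; otherwise, having passed the left end, place the held item in a new position at the front of the word (all existing positions shift up by one); the result is the new state. *)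

theory Defs
  imports "HOL-Probability.Probability" "HOL-Library.Extended_Nat" "HOL-Library.Monad_Syntax"
begin

text \<open>The symbol \<open>-\<close> is encoded as \<open>\<infinity>\<close>, so that the order of \<^typ>\<open>enat\<close> is exactly
  the comparison convention for entries of a word.\<close>

type_synonym flag_word = "nat \<Rightarrow> enat"

definition flag_states :: "nat \<Rightarrow> flag_word set" where
  "flag_states b = {s. (\<forall>k\<in>{1..b}. \<exists>!i. s i = enat k) \<and> (\<forall>i. s i \<in> enat ` {1..b} \<or> s i = \<infinity>)}"

definition flag_length :: "flag_word \<Rightarrow> nat" where
  "flag_length s = card {(i, j). i < j \<and> s i > s j}"

text \<open>\<open>visit q s h p\<close> is the law of the final word when the word is currently \<open>s\<close>, the item \<open>h\<close>
  is held and position \<open>p\<close> is pointed at. The coin shows heads (\<^const>\<open>True\<close>) with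
  probability \<open>1 / q\<close>; \<open>L\<close> collects the positions further left where the leftward move could
  stop, of which it reaches the largest first.\<close>

function visit :: "real \<Rightarrow> flag_word \<Rightarrow> enat \<Rightarrow> nat \<Rightarrow> flag_word pmf" where
  "visit q s h p = do {
     heads \<leftarrow> bernoulli_pmf (1 / q);
     let s' = (if heads then s else s(p := h));
         h' = (if heads then h else s p);
         L = {i. i < p \<and> s' i < h'}
     in if L = {} then return_pmf (case_nat h' s') else visit q s' h' (Max L)
   }"
  by pat_completeness auto
termination
proof (relation "Wellfounded.measure (\<lambda>(q, s, h, p). p)", goal_cases)
  case 1
  show ?case by simp
next
  case (2 q s h p heads s' h' L)
  have "finite L" using 2 by simp
  then have "Max L \<in> L" using 2 by (intro Max_in) auto
  then show ?case using 2 by simp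
qed

declare visit.simps [simp del]

definition backward_flag_chain :: "real \<Rightarrow> flag_word \<Rightarrow> flag_word pmf" where
  "backward_flag_chain q s = visit q s \<infinity> (Max {i. s i \<noteq> \<infinity>})"

text \<open>The first conjunct says that \<open>K\<close> is a Markov chain on the state space \<open>S\<close>; the next two that
  \<open>\<mu>\<close> is a probability distribution on \<open>S\<close>; the last is the balance equation.\<close>

definition stationary_distribution :: "'a set \<Rightarrow> ('a \<Rightarrow> 'a pmf) \<Rightarrow> ('a \<Rightarrow> real) \<Rightarrow> bool" where
  "stationary_distribution S K \<mu> \<longleftrightarrow>
     (\<forall>x\<in>S. set_pmf (K x) \<subseteq> S) \<and>
     (\<forall>x\<in>S. \<mu> x \<ge> 0) \<and> (\<mu> has_sum 1) S \<and>
     (\<forall>y\<in>S. ((\<lambda>x. \<mu> x * pmf (K x) y) has_sum \<mu> y) S)"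

end

theory Submission
  imports Defs
begin

text \<open>The leftward sweep of the held item is a composition of adjacent moves: with the held item
  \<open>h\<close> inserted directly behind the entry \<open>a\<close>, the pair \<open>a h\<close> becomes \<open>h a\<close> with probability
  \<open>1\<close> if \<open>a \<ge> h\<close> and with probability \<open>1 / q\<close> if \<open>a < h\<close>, and otherwise stays as it is, with
  \<open>a\<close> as the new held item. This is a Metropolis move satisfying detailed balance for the weight
  \<open>q\<close> to the power of minus the number of inversions. The chain is the limit of the sweeps that
  start at position \<open>n\<close>, so stationarity follows by dominated convergence. The weights sum to
  \<open>1\<close> because an entry \<open>1\<close> at position \<open>p\<close> causes exactly \<open>p\<close> inversions: a random
  state arises by inserting successive smallest entries at independent geometric positions.\<close>

section \<open>Sums against a pmf and Metropolis moves\<close>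

lemma has_sum_pmf_mult:
  fixes f :: "'a \<Rightarrow> real"
  assumes "set_pmf M \<subseteq> S" and "\<And>x. \<bar>f x\<bar> \<le> B"
  shows "((\<lambda>x. pmf M x * f x) has_sum measure_pmf.expectation M f) S"
proof -
  have int: "integrable (measure_pmf M) f"
    using assms(2) by (intro measure_pmf.integrable_const_bound[where B = B]) auto
  \<comment> \<open>A pmf is a density over counting measure, so integrability of the bounded
    \<open>f\<close> becomes absolute summability of the product.\<close>
  then have "Infinite_Set_Sum.abs_summable_on (\<lambda>x. pmf M x * f x) UNIV"
    by (subst (asm) measure_pmf_eq_density)
      (simp add: integrable_density abs_summable_on_def)
  then have summ: "(\<lambda>x. pmf M x * f x) summable_on UNIV"
    and "infsetsum (\<lambda>x. pmf M x * f x) UNIV = infsum (\<lambda>x. pmf M x * f x) UNIV"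
    using abs_summable_summable[OF abs_summable_equivalent[THEN iffD2]]
    by (auto simp: infsetsum_infsum)
  then have "((\<lambda>x. pmf M x * f x) has_sum measure_pmf.expectation M f) UNIV"
    by (simp add: pmf_expectation_eq_infsetsum has_sum_infsum)
  moreover have "pmf M x = 0" if "x \<notin> S" for x
    using that assms(1) by (auto simp: pmf_eq_0_set_pmf)
  ultimately show ?thesis
    by (subst has_sum_cong_neutral[where T = UNIV]) auto
qed

definition metropolis :: "('a \<Rightarrow> 'a) \<Rightarrow> ('a \<Rightarrow> real) \<Rightarrow> 'a \<Rightarrow> 'a pmf" where
  "metropolis T \<alpha> x = map_pmf (\<lambda>accept. if accept then T x else x) (bernoulli_pmf (\<alpha> x))"

text \<open>Since \<open>T\<close> is an involution, \<open>y\<close> is reached only from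
  \<open>T y\<close> by acceptance and from \<open>y\<close> by rejection. Balance equates the
  accepted mass arriving from \<open>T y\<close> with the mass of \<open>y\<close> lost to
  acceptance.\<close>

lemma metropolis_stationary:
  assumes T: "\<And>x. T (T x) = x" and \<alpha>: "\<And>x. 0 \<le> \<alpha> x" "\<And>x. \<alpha> x \<le> 1"
    and balance: "\<And>x. pmf M (T x) * \<alpha> (T x) = pmf M x * \<alpha> x"
  shows "bind_pmf M (metropolis T \<alpha>) = M"
proof (rule pmf_eqI)
  fix y
  have "pmf (metropolis T \<alpha> x) y = indicator {T y} x * \<alpha> x + indicator {y} x * (1 - \<alpha> x)" for x
  proof -
    have "metropolis T \<alpha> x = bind_pmf (bernoulli_pmf (\<alpha> x)) (\<lambda>c. return_pmf (if c then T x else x))"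
      by (simp add: metropolis_def map_pmf_def)
    then have "pmf (metropolis T \<alpha> x) y
        = indicator {y} (T x) * \<alpha> x + indicator {y} x * (1 - \<alpha> x)"
      using \<alpha>[of x] by (simp add: pmf_bind pmf_return indicator_def)
    moreover have "T x = y \<longleftrightarrow> x = T y"
      using T by metis
    ultimately show ?thesis
      by (simp add: indicator_def)
  qed
  then have "pmf (bind_pmf M (metropolis T \<alpha>)) y
      = (\<integral>x. indicator {T y} x * \<alpha> x + indicator {y} x * (1 - \<alpha> x) \<partial>measure_pmf M)"
    by (simp add: pmf_bind)
  also have "\<dots> = (\<integral>x. indicator {T y} x * \<alpha> x \<partial>measure_pmf M)
      + (\<integral>x. indicator {y} x * (1 - \<alpha> x) \<partial>measure_pmf M)"
    using \<alpha> by (intro Bochner_Integration.integral_add measure_pmf.integrable_const_bound[where B = 1])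
      (auto simp: indicator_def)
  also have "\<dots> = pmf M (T y) * \<alpha> (T y) + pmf M y * (1 - \<alpha> y)"
  proof -
    have "(\<integral>x. indicator {z} x * f x \<partial>measure_pmf M) = pmf M z * f z" for z and f :: "'a \<Rightarrow> real"
      by (subst integral_measure_pmf_real[where A = "{z}"]) (auto simp: indicator_def split: if_splits)
    then show ?thesis by simp
  qed
  also have "\<dots> = pmf M y"
    using balance[of y] by (simp add: algebra_simps)
  finally show "pmf (bind_pmf M (metropolis T \<alpha>)) y = pmf M y" .
qed

section \<open>Inversions and adjacent transpositions\<close>

definition inversions :: "flag_word \<Rightarrow> (nat \<times> nat) set" where
  "inversions s = {(i, j). i < j \<and> s i > s j}"

lemma flag_length_inversions: "flag_length s = card (inversions s)"
  by (simp add: flag_length_def inversions_def)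

lemma finite_flag_states:
  assumes "s \<in> flag_states b"
  shows "finite {i. s i \<noteq> \<infinity>}"
proof -
  have "finite {i. s i = enat k}" if "k \<in> {1..b}" for k
  proof -
    have "\<exists>!i. s i = enat k"
      using assms that by (simp add: flag_states_def)
    then obtain i where "{i. s i = enat k} = {i}"
      by auto
    then show ?thesis by simp
  qed
  then have "finite (\<Union>k\<in>{1..b}. {i. s i = enat k})"
    by blast
  then show ?thesis
    by (rule rev_finite_subset) (use assms in \<open>auto simp: flag_states_def\<close>)
qed

text \<open>The right end of an inversion carries a number, never \<infinity>, which leaves finitely
  many right ends and finitely many positions left of each. Finiteness matters because
  \<open>card\<close> is 0 on infinite sets.\<close>

lemma finite_inversions:
  assumes "s \<in> flag_states b"
  shows "finite (inversions s)"
proof (rule finite_subset)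
  have "e \<noteq> \<infinity>" if "e < f" for e f :: enat
    using that by (cases e) auto
  then show "inversions s \<subseteq> (\<Union>j\<in>{i. s i \<noteq> \<infinity>}. {..<j} \<times> {j})"
    unfolding inversions_def by blast
  show "finite (\<Union>j\<in>{i. s i \<noteq> \<infinity>}. {..<j} \<times> {j})"
    using finite_flag_states[OF assms] by blast
qed

definition swap_at :: "nat \<Rightarrow> flag_word \<Rightarrow> flag_word" where
  "swap_at i s = s \<circ> Transposition.transpose i (Suc i)"

lemma swap_at_swap_at [simp]: "swap_at i (swap_at i s) = s"
  by (simp add: swap_at_def comp_assoc)

lemma swap_at_flag_states:
  assumes "s \<in> flag_states b"
  shows "swap_at i s \<in> flag_states b"
proof -
  let ?t = "Transposition.transpose i (Suc i)"
  have "\<exists>!j. s (?t j) = e" if "\<exists>!j. s j = e" for e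
    using that by (metis transpose_involutory)
  then show ?thesis
    using assms by (auto simp: flag_states_def swap_at_def)
qed

lemma swap_at_flag_states_iff: "swap_at i s \<in> flag_states b \<longleftrightarrow> s \<in> flag_states b"
  using swap_at_flag_states swap_at_swap_at by metis

text \<open>The transposition keeps the relative order of every pair of positions except
  \<open>i\<close>, \<open>Suc i\<close>, and this ascent turns into one new inversion.\<close>

lemma flag_length_swap_at:
  assumes "s \<in> flag_states b" and "s i < s (Suc i)"
  shows "flag_length (swap_at i s) = Suc (flag_length s)"
proof -
  let ?t = "Transposition.transpose i (Suc i)"
  have less: "?t x < ?t y \<longleftrightarrow> x < y \<and> (x, y) \<noteq> (i, Suc i) \<or> (x, y) = (Suc i, i)" for x y
    by (auto simp: Transposition.transpose_def)
  \<comment> \<open>The added pair is written in decreasing order: it is not an inversion of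
    \<open>s\<close>, and its image \<open>(i, Suc i)\<close> is the new inversion.\<close>
  have "inversions (swap_at i s) = map_prod ?t ?t ` insert (Suc i, i) (inversions s)"
  proof (intro set_eqI iffI)
    fix z assume "z \<in> inversions (swap_at i s)"
    then obtain x y where z: "z = (x, y)" "x < y" "s (?t x) > s (?t y)"
      by (auto simp: inversions_def swap_at_def)
    then have "(?t x, ?t y) \<in> insert (Suc i, i) (inversions s)"
      using less[of "?t x" "?t y"] by (auto simp: inversions_def)
    moreover have "z = map_prod ?t ?t (?t x, ?t y)"
      using z by simp
    ultimately show "z \<in> map_prod ?t ?t ` insert (Suc i, i) (inversions s)"
      by blast
  next
    fix z assume "z \<in> map_prod ?t ?t ` insert (Suc i, i) (inversions s)"
    then obtain w where w: "w \<in> insert (Suc i, i) (inversions s)" "z = map_prod ?t ?t w"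
      by (rule imageE)
    obtain x y where "w = (x, y)"
      by (cases w)
    with w have "z = (?t x, ?t y)" "(x, y) \<in> insert (Suc i, i) (inversions s)"
      by simp_all
    then show "z \<in> inversions (swap_at i s)"
      using less[of x y] assms(2) by (auto simp: inversions_def swap_at_def)
  qed
  moreover have "inj_on (map_prod ?t ?t) A" for A
    by (intro inj_on_subset[OF prod.inj_map] inj_transpose) auto
  ultimately have "flag_length (swap_at i s) = card (insert (Suc i, i) (inversions s))"
    by (metis card_image flag_length_inversions)
  moreover have "(Suc i, i) \<notin> inversions s"
    by (simp add: inversions_def)
  ultimately show ?thesis
    using finite_inversions[OF assms(1)]
    by (simp add: flag_length_inversions)
qed

section \<open>The chain as a sweep of adjacent moves\<close>

definition insert_at :: "nat \<Rightarrow> enat \<Rightarrow> flag_word \<Rightarrow> flag_word" where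
  "insert_at p h s i = (if i < p then s i else if i = p then h else s (i - 1))"

definition move :: "real \<Rightarrow> nat \<Rightarrow> flag_word \<Rightarrow> flag_word pmf" where
  "move q i = metropolis (swap_at i) (\<lambda>s. if s i < s (Suc i) then 1 / q else 1)"

fun sweep :: "real \<Rightarrow> nat \<Rightarrow> flag_word \<Rightarrow> flag_word pmf" where
  "sweep q 0 s = return_pmf s"
| "sweep q (Suc n) s = bind_pmf (move q n s) (sweep q n)"

text \<open>In \<open>insert_at k h s\<close> the item \<open>h\<close> is held in front of position \<open>k\<close> of \<open>s\<close>, whose entries
  from \<open>k\<close> on have already been shifted up by one.\<close>

lemma swap_at_insert_at: "swap_at k (insert_at (Suc k) h s) = insert_at k h s"
  by (auto simp: swap_at_def insert_at_def Transposition.transpose_def fun_eq_iff)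

text \<open>One word read in two ways: if the swap is rejected, \<open>h\<close> counts as put down
  at \<open>k\<close> and \<open>s k\<close> as the new held item.\<close>

lemma insert_at_Suc: "insert_at (Suc k) h s = insert_at k (s k) (s(k := h))"
  by (auto simp: insert_at_def fun_eq_iff less_Suc_eq)

text \<open>At an entry \<open>s k < h\<close> the coin of \<open>visit\<close> is the acceptance of
  \<open>move\<close>: heads carries \<open>h\<close> past the entry, tails makes \<open>s k\<close>
  the held item. An entry not below \<open>h\<close> is passed with certainty, as in the leftward
  search. Tails changes both \<open>h\<close> and \<open>s\<close>, so the induction is general in
  them.\<close>

lemma sweep_insert_at:
  "sweep q k (insert_at k h s) =
    (let L = {i. i < k \<and> s i < h}
     in if L = {} then return_pmf (case_nat h s) else visit q s h (Max L))"
proof (induction k arbitrary: h s)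
  case 0
  have "insert_at 0 h s = case_nat h s"
    by (auto simp: insert_at_def fun_eq_iff split: nat.split)
  then show ?case by simp
next
  case (Suc k)
  let ?w = "insert_at (Suc k) h s"
  have w: "?w k = s k" "?w (Suc k) = h"
    by (auto simp: insert_at_def)
  show ?case
  proof (cases "s k < h")
    case True
    let ?L = "{i. i < Suc k \<and> s i < h}"
    have "Max ?L = k"
      using True by (intro Max_eqI) auto
    moreover have "?L \<noteq> {}"
      using True by auto
    moreover have "sweep q (Suc k) ?w = bind_pmf (bernoulli_pmf (1 / q))
        (\<lambda>heads. if heads then sweep q k (insert_at k h s)
          else sweep q k (insert_at k (s k) (s(k := h))))"
      using True w by (simp add: move_def metropolis_def bind_map_pmf if_distrib swap_at_insert_at
          insert_at_Suc[symmetric] cong: if_cong)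
    moreover have "visit q s h k = bind_pmf (bernoulli_pmf (1 / q))
        (\<lambda>heads. if heads then sweep q k (insert_at k h s)
          else sweep q k (insert_at k (s k) (s(k := h))))"
      unfolding Suc.IH
    proof (subst visit.simps, intro bind_pmf_cong refl, goal_cases)
      case (1 heads)
      then show ?case
        by (cases heads) (simp_all add: Let_def del: fun_upd_apply)
    qed
    ultimately show ?thesis
      by (simp only: Let_def if_False)
  next
    case False
    then have "{i. i < Suc k \<and> s i < h} = {i. i < k \<and> s i < h}"
      by (auto simp: less_Suc_eq)
    moreover have "bernoulli_pmf 1 = return_pmf True"
      by (rule pmf_eqI) (simp add: pmf_return indicator_def split: bool.split)
    then have "sweep q (Suc k) ?w = sweep q k (insert_at k h s)"
      using False w by (simp add: move_def metropolis_def bind_return_pmf swap_at_insert_at)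
    ultimately show ?thesis
      using Suc.IH by simp
  qed
qed

text \<open>From \<open>n\<close> on all entries are \<infinity>, so inserting the initially held
  \<infinity> there leaves the word unchanged, and the search from \<open>n\<close> first stops at
  the rightmost number.\<close>

lemma backward_flag_chain_sweep:
  assumes "{i. s i \<noteq> \<infinity>} \<noteq> {}" and "{i. s i \<noteq> \<infinity>} \<subseteq> {..<n}"
  shows "backward_flag_chain q s = sweep q n s"
proof -
  have L: "{i. i < n \<and> s i < \<infinity>} = {i. s i \<noteq> \<infinity>}"
    using assms(2) by auto
  have "s i = \<infinity>" if "i \<ge> n" for i
    using assms(2) that by (auto simp: subset_iff not_less[symmetric])
  then have ins: "insert_at n \<infinity> s = s"
    by (auto simp: insert_at_def fun_eq_iff not_less)
  show ?thesis
    using sweep_insert_at[of q n \<infinity> s] assms(1)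
    unfolding backward_flag_chain_def Let_def L ins by (simp only: if_False)
qed

lemma set_pmf_sweep:
  assumes "s \<in> flag_states b"
  shows "set_pmf (sweep q n s) \<subseteq> flag_states b"
  using assms
proof (induction n arbitrary: s)
  case (Suc n)
  then have "set_pmf (move q n s) \<subseteq> flag_states b"
    by (auto simp: move_def metropolis_def swap_at_flag_states)
  with Suc.IH show ?case
    by (auto simp: subset_iff)
qed simp

section \<open>States built by inserting a smallest entry\<close>

text \<open>The increasing enumeration of the positions other than \<open>p\<close>; it sends a
  position before an insertion at \<open>p\<close> to its position afterwards.\<close>

definition skip :: "nat \<Rightarrow> nat \<Rightarrow> nat" where
  "skip p i = (if i < p then i else Suc i)"

lemma skip_less_iff [simp]: "skip p i < skip p j \<longleftrightarrow> i < j"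
  by (auto simp: skip_def)

lemma skip_eq_iff [simp]: "skip p i = skip p j \<longleftrightarrow> i = j"
  by (auto simp: skip_def)

lemma skip_neq [simp]: "skip p i \<noteq> p" "p \<noteq> skip p i"
  by (auto simp: skip_def)

lemma skip_cases [case_names eq skip]:
  obtains "j = p" | i where "j = skip p i"
proof (cases j p rule: linorder_cases)
  case less
  then show ?thesis using that(2)[of j] by (simp add: skip_def)
next
  case greater
  then show ?thesis using that(2)[of "j - 1"] by (simp add: skip_def)
qed (use that in blast)

lemma all_skip: "(\<forall>j. P j) \<longleftrightarrow> P p \<and> (\<forall>i. P (skip p i))"
  by (metis skip_cases)

lemma ex1_skip: "(\<exists>!j. P j) \<longleftrightarrow> (if P p then \<forall>i. \<not> P (skip p i) else \<exists>!i. P (skip p i))"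
proof (cases "P p")
  case True
  then have "(\<exists>!j. P j) \<longleftrightarrow> (\<forall>j. P j \<longrightarrow> j = p)"
    by blast
  also have "\<dots> \<longleftrightarrow> (\<forall>i. \<not> P (skip p i))"
    by (subst all_skip[of _ p]) simp
  finally show ?thesis
    using True by simp
next
  case False
  have "(\<exists>j. P j \<and> (\<forall>k. P k \<longrightarrow> k = j)) \<longleftrightarrow> (\<exists>i. P (skip p i) \<and> (\<forall>k. P k \<longrightarrow> k = skip p i))"
    using False by (metis skip_cases)
  also have "\<dots> \<longleftrightarrow> (\<exists>i. P (skip p i) \<and> (\<forall>k. P (skip p k) \<longrightarrow> k = i))"
    using False by (subst all_skip[of _ p]) simp
  finally show ?thesis
    using False by (simp add: Ex1_def)
qed

lemma insert_at_same [simp]: "insert_at p h s p = h"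
  by (simp add: insert_at_def)

lemma insert_at_skip [simp]: "insert_at p h s (skip p i) = s i"
  by (simp add: insert_at_def skip_def)

lemma flag_states_pos:
  assumes "t \<in> flag_states b"
  shows "t i > 0"
proof -
  have "t i \<in> enat ` {1..b} \<or> t i = \<infinity>"
    using assms by (simp add: flag_states_def)
  then show ?thesis by (auto simp: zero_enat_def)
qed

lemma eSuc_eq_1_iff: "eSuc e = 1 \<longleftrightarrow> e = 0"
  by (metis eSuc_inject one_eSuc)

text \<open>\<open>eSuc\<close> renames each number \<open>k\<close> to \<open>k + 1\<close> and
  fixes \<infinity>, which frees the label 1 for the inserted entry.\<close>

lemma insert_at_flag_states_iff:
  "insert_at p 1 (eSuc \<circ> t) \<in> flag_states (Suc b) \<longleftrightarrow> t \<in> flag_states b"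
proof -
  let ?s = "insert_at p 1 (eSuc \<circ> t)"
  \<comment> \<open>An entry 0 of \<open>t\<close> would become a legal 1, hence the range from 0;
    uniqueness of the entry 1 excludes it below.\<close>
  have entries: "(\<forall>j. ?s j \<in> enat ` {1..Suc b} \<or> ?s j = \<infinity>)
      \<longleftrightarrow> (\<forall>i. t i \<in> enat ` {0..b} \<or> t i = \<infinity>)"
  proof -
    have "eSuc e \<in> enat ` {1..Suc b} \<longleftrightarrow> e \<in> enat ` {0..b}" for e
      by (cases e) (auto simp: eSuc_enat)
    moreover have "eSuc e = \<infinity> \<longleftrightarrow> e = \<infinity>" for e
      by (cases e) (auto simp: eSuc_enat)
    moreover have "1 \<in> enat ` {1..Suc b}"
      by (auto simp: one_enat_def)
    ultimately show ?thesis
      by (subst all_skip[of _ p]) simp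
  qed
  have ex1_1: "(\<exists>!j. ?s j = enat 1) \<longleftrightarrow> (\<forall>i. t i \<noteq> 0)"
    by (subst ex1_skip[of _ p])
      (simp add: one_enat_def[symmetric] eSuc_eq_1_iff del: One_nat_def)
  have ex1_Suc: "(\<exists>!j. ?s j = enat (Suc k)) \<longleftrightarrow> (\<exists>!i. t i = enat k)" if "k \<ge> 1" for k
    using that by (subst ex1_skip[of _ p]) (simp add: one_enat_def flip: eSuc_enat)
  have "{1..Suc b} = insert 1 (Suc ` {1..b})"
    by (auto simp: image_Suc_atLeastAtMost)
  then have numbers: "(\<forall>k\<in>{1..Suc b}. \<exists>!j. ?s j = enat k)
      \<longleftrightarrow> (\<forall>i. t i \<noteq> 0) \<and> (\<forall>k\<in>{1..b}. \<exists>!i. t i = enat k)"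
    using ex1_1 ex1_Suc by (simp del: One_nat_def image_Suc_atLeastAtMost)
  have "(t i \<in> enat ` {1..b} \<or> t i = \<infinity>)
      \<longleftrightarrow> (t i \<in> enat ` {0..b} \<or> t i = \<infinity>) \<and> t i \<noteq> 0" for i
    by (auto simp: zero_enat_def Suc_le_eq)
  then have pos: "(\<forall>i. t i \<in> enat ` {1..b} \<or> t i = \<infinity>)
      \<longleftrightarrow> (\<forall>i. t i \<in> enat ` {0..b} \<or> t i = \<infinity>) \<and> (\<forall>i. t i \<noteq> 0)"
    by (simp only: all_conj_distrib)
  show ?thesis
    unfolding flag_states_def mem_Collect_eq entries numbers pos by (simp only: conj_ac)
qed

text \<open>The inverse deletes the entry 1 and lowers all others. The position \<open>p\<close> is
  determined because \<open>eSuc\<close> of a positive entry is never 1.\<close>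

lemma bij_betw_insert_at:
  "bij_betw (\<lambda>(p, t). insert_at p 1 (eSuc \<circ> t)) (UNIV \<times> flag_states b) (flag_states (Suc b))"
proof (rule bij_betw_imageI)
  show "inj_on (\<lambda>(p, t). insert_at p 1 (eSuc \<circ> t)) (UNIV \<times> flag_states b)"
  proof (rule inj_onI, clarify)
    fix p t p' t'
    assume t: "t \<in> flag_states b" and t': "t' \<in> flag_states b"
      and eq: "insert_at p 1 (eSuc \<circ> t) = insert_at p' 1 (eSuc \<circ> t')"
    have p: "p = p'"
    proof (cases p p' rule: skip_cases)
      case (skip i)
      then have "eSuc (t' i) = 1"
        using fun_cong[OF eq, of p] by simp
      then show ?thesis
        using flag_states_pos[OF t', of i] by (simp add: eSuc_eq_1_iff)
    qed
    moreover have "t i = t' i" for i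
      using fun_cong[OF eq, of "skip p i"] p by simp
    ultimately show "p = p' \<and> t = t'"
      by blast
  qed
  show "(\<lambda>(p, t). insert_at p 1 (eSuc \<circ> t)) ` (UNIV \<times> flag_states b) = flag_states (Suc b)"
  proof (intro equalityI subsetI)
    fix s assume s: "s \<in> flag_states (Suc b)"
    then have "\<exists>i. s i = enat 1"
      unfolding flag_states_def by force
    then obtain p where p: "s p = 1"
      by (auto simp: one_enat_def)
    \<comment> \<open>Truncated subtraction loses nothing here: entries of a state are positive, and
      \<infinity> stays \<infinity>.\<close>
    define t where "t i = s (skip p i) - 1" for i
    have "eSuc (t i) = s (skip p i)" for i
      using flag_states_pos[OF s, of "skip p i"]
      by (cases "s (skip p i)") (auto simp: t_def eSuc_enat one_enat_def zero_enat_def)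
    then have "s j = insert_at p 1 (eSuc \<circ> t) j" for j
      using p by (cases j p rule: skip_cases) auto
    then have "s = insert_at p 1 (eSuc \<circ> t)"
      by blast
    moreover from this have "t \<in> flag_states b"
      using s insert_at_flag_states_iff by simp
    ultimately show "s \<in> (\<lambda>(p, t). insert_at p 1 (eSuc \<circ> t)) ` (UNIV \<times> flag_states b)"
      by auto
  qed (auto simp: insert_at_flag_states_iff)
qed

text \<open>The inserted 1 is strictly below every other entry, so it is inverted with exactly the
  \<open>p\<close> entries on its left. The other inversions survive because \<open>eSuc\<close> and
  \<open>skip p\<close> are strictly increasing.\<close>

lemma flag_length_insert_at:
  assumes "t \<in> flag_states b"
  shows "flag_length (insert_at p 1 (eSuc \<circ> t)) = p + flag_length t"
proof -
  let ?s = "insert_at p 1 (eSuc \<circ> t)"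
  have gt_1: "1 < eSuc (t i)" for i
    using flag_states_pos[OF assms, of i] by (metis eSuc_mono one_eSuc)
  have "(x, y) \<in> inversions ?s
      \<longleftrightarrow> (x, y) \<in> {..<p} \<times> {p} \<union> map_prod (skip p) (skip p) ` inversions t" for x y
  proof (cases x p rule: skip_cases; cases y p rule: skip_cases)
    fix i assume "x = skip p i" "y = p"
    then show ?thesis
      using gt_1[of i] by (auto simp: inversions_def)
  next
    fix j assume "x = p" "y = skip p j"
    then show ?thesis
      using gt_1[of j] by (auto simp: inversions_def)
  qed (auto simp: inversions_def)
  then have "inversions ?s = {..<p} \<times> {p} \<union> map_prod (skip p) (skip p) ` inversions t"
    by auto
  moreover have "inj_on (map_prod (skip p) (skip p)) (inversions t)"
    by (auto simp: inj_on_def)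
  moreover have "{..<p} \<times> {p} \<inter> map_prod (skip p) (skip p) ` inversions t = {}"
    by auto
  ultimately show ?thesis
    using finite_inversions[OF assms]
    by (simp add: flag_length_inversions card_Un_disjoint card_image)
qed

section \<open>The weights as a probability law\<close>

text \<open>The geometric law counts failures from 0, so position \<open>p\<close> has mass
  \<open>(1 - inverse q) * inverse q ^ p\<close>, matching the \<open>p\<close> inversions created.
  Being a pmf, the law has total mass 1 by construction.\<close>

fun flag_pmf :: "real \<Rightarrow> nat \<Rightarrow> flag_word pmf" where
  "flag_pmf q 0 = return_pmf (\<lambda>_. \<infinity>)"
| "flag_pmf q (Suc b) = map_pmf (\<lambda>(p, t). insert_at p 1 (eSuc \<circ> t))
     (pair_pmf (geometric_pmf (1 - inverse q)) (flag_pmf q b))"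

lemma flag_states_0: "flag_states 0 = {\<lambda>_. \<infinity>}"
  by (auto simp: flag_states_def)

lemma set_pmf_flag_pmf:
  assumes "q > 1"
  shows "set_pmf (flag_pmf q b) = flag_states b"
proof (induction b)
  case (Suc b)
  have "0 < 1 - inverse q" "1 - inverse q < 1"
    using assms by (auto simp: field_simps)
  then show ?case
    using Suc bij_betw_imp_surj_on[OF bij_betw_insert_at[of b]]
    by (simp add: set_pmf_geometric)
qed (simp add: flag_states_0)

lemma pmf_flag_pmf:
  assumes "q > 1" and "s \<in> flag_states b"
  shows "pmf (flag_pmf q b) s = (1 - inverse q) ^ b * inverse q ^ flag_length s"
  using assms(2)
proof (induction b arbitrary: s)
  case 0
  then show ?case by (simp add: flag_states_0 flag_length_def)
next
  case (Suc b)
  have q: "0 < 1 - inverse q" "1 - inverse q < 1"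
    using assms by (auto simp: field_simps)
  obtain p t where t: "t \<in> flag_states b" and s: "s = insert_at p 1 (eSuc \<circ> t)"
    using bij_betw_imp_surj_on[OF bij_betw_insert_at[of b]] Suc.prems
    by (force simp: set_eq_iff image_iff)
  \<comment> \<open>Insertion is injective on the support
    \<open>UNIV \<times> flag_states b\<close>, so the mass of \<open>s\<close> is that of its
    single preimage there.\<close>
  have "pmf (flag_pmf q (Suc b)) s
      = pmf (pair_pmf (geometric_pmf (1 - inverse q)) (flag_pmf q b)) (p, t)"
    unfolding flag_pmf.simps s
    by (subst pmf_map_inj[where x = "(p, t)", symmetric])
      (use q t bij_betw_insert_at[of b] assms in
        \<open>auto simp: set_pmf_flag_pmf set_pmf_geometric bij_betw_def\<close>)
  also have "\<dots> = (1 - inverse q) ^ Suc b * inverse q ^ flag_length s"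
    using q t by (simp add: pmf_pair Suc.IH s flag_length_insert_at power_add)
  finally show ?case .
qed

section \<open>Invariance under moves, sweeps and the chain\<close>

text \<open>Swapping an ascent costs a factor \<open>1 / q\<close> in weight, which is its
  acceptance probability, while the reverse move is certain. A descent is the same equation read
  from the swapped word.\<close>

lemma bind_flag_pmf_move:
  assumes "q > 1"
  shows "bind_pmf (flag_pmf q b) (move q i) = flag_pmf q b"
  unfolding move_def
proof (rule metropolis_stationary)
  fix s
  let ?\<alpha> = "\<lambda>s :: flag_word. if s i < s (Suc i) then 1 / q else 1"
  have swap: "swap_at i s i = s (Suc i)" "swap_at i s (Suc i) = s i" for s
    by (simp_all add: swap_at_def)
  have up: "pmf (flag_pmf q b) (swap_at i s) = pmf (flag_pmf q b) s * (1 / q)"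
    if "s \<in> flag_states b" "s i < s (Suc i)" for s
    using that assms
    by (simp add: pmf_flag_pmf swap_at_flag_states flag_length_swap_at field_simps)
  show "pmf (flag_pmf q b) (swap_at i s) * ?\<alpha> (swap_at i s) = pmf (flag_pmf q b) s * ?\<alpha> s"
  proof (cases "s \<in> flag_states b")
    case True
    consider "s i < s (Suc i)" | "s i = s (Suc i)" | "s (Suc i) < s i"
      by (rule linorder_cases)
    then show ?thesis
    proof cases
      case 1
      then show ?thesis using up[OF True] by (simp add: swap)
    next
      case 2
      then have "swap_at i s = s"
        by (auto simp: swap_at_def Transposition.transpose_def)
      then show ?thesis by simp
    next
      case 3
      then show ?thesis
        using up[of "swap_at i s"] swap_at_flag_states[OF True, of i] by (simp add: swap)
    qed
  next
    case False
    \<comment> \<open>Balance is required of all words; outside the state space both sides vanish,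
      as swapping preserves being a state.\<close>
    then have "pmf (flag_pmf q b) s = 0" "pmf (flag_pmf q b) (swap_at i s) = 0"
      using assms by (simp_all add: pmf_eq_0_set_pmf set_pmf_flag_pmf swap_at_flag_states_iff)
    then show ?thesis by simp
  qed
qed (use assms in auto)

lemma bind_flag_pmf_sweep:
  assumes "q > 1"
  shows "bind_pmf (flag_pmf q b) (sweep q n) = flag_pmf q b"
proof (induction n)
  case 0
  then show ?case by (simp add: bind_return_pmf')
next
  case (Suc n)
  have "bind_pmf (flag_pmf q b) (sweep q (Suc n))
      = bind_pmf (bind_pmf (flag_pmf q b) (move q n)) (sweep q n)"
    by (simp add: bind_assoc_pmf cong: bind_pmf_cong)
  with Suc show ?case
    by (simp only: bind_flag_pmf_move[OF assms])
qed

text \<open>The threshold must exceed every numbered position of \<open>s\<close>. It is unbounded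
  over the states, so invariance under each sweep reaches the chain only through a limit.\<close>

lemma backward_flag_chain_eventually_sweep:
  assumes "b \<ge> 1" and "s \<in> flag_states b"
  shows "\<forall>\<^sub>F n in sequentially. backward_flag_chain q s = sweep q n s"
proof -
  obtain N where N: "{i. s i \<noteq> \<infinity>} \<subseteq> {..<N}"
    using finite_flag_states[OF assms(2)] finite_nat_iff_bounded by blast
  obtain i where "s i = enat 1"
    using assms by (fastforce simp: flag_states_def)
  then have "{i. s i \<noteq> \<infinity>} \<noteq> {}"
    by (metis (mono_tags) empty_iff enat.distinct(2) mem_Collect_eq)
  then show ?thesis
    using N by (intro eventually_sequentiallyI[of N] backward_flag_chain_sweep) auto
qed

lemma bind_flag_pmf_backward_flag_chain:
  assumes "q > 1" and "b \<ge> 1"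
  shows "bind_pmf (flag_pmf q b) (backward_flag_chain q) = flag_pmf q b"
proof (rule pmf_eqI)
  fix y
  let ?M = "flag_pmf q b"
  \<comment> \<open>The integrands are at most 1 and eventually constant in \<open>n\<close> on the
    support; the integrals all equal \<open>pmf ?M y\<close>, hence so does their limit.\<close>
  have "(\<lambda>n. \<integral>s. pmf (sweep q n s) y \<partial>measure_pmf ?M)
      \<longlonglongrightarrow> (\<integral>s. pmf (backward_flag_chain q s) y \<partial>measure_pmf ?M)"
  proof (rule integral_dominated_convergence[where w = "\<lambda>_. 1"])
    have "(\<lambda>n. pmf (sweep q n s) y) \<longlonglongrightarrow> pmf (backward_flag_chain q s) y"
      if "s \<in> flag_states b" for s
      using backward_flag_chain_eventually_sweep[OF assms(2) that, of q]
      by (intro tendsto_eventually) (auto elim: eventually_mono)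
    then show "AE s in measure_pmf ?M.
        (\<lambda>n. pmf (sweep q n s) y) \<longlonglongrightarrow> pmf (backward_flag_chain q s) y"
      by (simp add: AE_measure_pmf_iff set_pmf_flag_pmf[OF assms(1)])
  qed (auto simp: pmf_le_1)
  moreover have "(\<integral>s. pmf (sweep q n s) y \<partial>measure_pmf ?M) = pmf ?M y" for n
    by (simp add: pmf_bind[symmetric] bind_flag_pmf_sweep[OF assms(1)])
  ultimately show "pmf (bind_pmf ?M (backward_flag_chain q)) y = pmf ?M y"
    by (simp add: pmf_bind LIMSEQ_const_iff)
qed

theorem theorem4p4:
  fixes q :: real and b :: nat
  assumes "q > 1" and "b \<ge> 1"
  shows "stationary_distribution (flag_states b) (backward_flag_chain q)
           (\<lambda>\<tau>. (1 - inverse q) ^ b * inverse q ^ flag_length \<tau>)"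
proof -
  let ?\<mu> = "\<lambda>\<tau>. (1 - inverse q) ^ b * inverse q ^ flag_length \<tau>"
  note \<mu> = pmf_flag_pmf[OF assms(1), symmetric]
  \<comment> \<open>Turns integrals into the \<open>has_sum\<close> form: \<open>f = 1\<close> gives
    the total mass, and \<open>f\<close> the transition probability into \<open>y\<close> gives the
    balance equation.\<close>
  have sum: "((\<lambda>x. ?\<mu> x * f x) has_sum measure_pmf.expectation (flag_pmf q b) f) (flag_states b)"
    if "\<And>x. \<bar>f x\<bar> \<le> 1" for f :: "flag_word \<Rightarrow> real"
    using has_sum_pmf_mult[of "flag_pmf q b" "flag_states b", OF _ that] assms(1)
    by (simp add: set_pmf_flag_pmf \<mu> cong: has_sum_cong)
  have "set_pmf (backward_flag_chain q s) \<subseteq> flag_states b" if s: "s \<in> flag_states b" for s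
  proof -
    obtain n where "backward_flag_chain q s = sweep q n s"
      using backward_flag_chain_eventually_sweep[OF assms(2) s]
        eventually_happens'[OF sequentially_bot] by blast
    then show ?thesis
      using set_pmf_sweep[OF s] by simp
  qed
  moreover have "(?\<mu> has_sum 1) (flag_states b)"
    using sum[of "\<lambda>_. 1"] by simp
  moreover have "((\<lambda>s. ?\<mu> s * pmf (backward_flag_chain q s) y) has_sum ?\<mu> y) (flag_states b)"
    if "y \<in> flag_states b" for y
    using sum[of "\<lambda>s. pmf (backward_flag_chain q s) y"] that
    by (simp add: pmf_le_1 pmf_bind[symmetric] bind_flag_pmf_backward_flag_chain[OF assms] \<mu>)
  ultimately show ?thesis
    using assms(1) by (auto simp: stationary_distribution_def field_simps)
qed

end
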